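(* Let $\rho\in(0,1)$, $n\ge1$ and $u_n>1$. Let $g_n$ be a Modular architecture with $n$ queues and $n$ servers and average degree $d_n\le\frac{\rho}{2}n$. Then there exists $\lambda_n\in\Lambda_n(u_n)$ such that $\lambda_n\notin\mathbf R(g_n)$.
   Context: Modular architecture: let $d_n$ be a positive integer dividing $n$. The set $J$ of $n$ servers is partitioned into $n/d_n$ subsets $B_1,\dots,B_{n/d_n}$ of cardinality $d_n$ each, and the set $I$ of $n$ queues is partitioned into $n/d_n$ subsets $A_1,\dots,A_{n/d_n}$ of cardinality $d_n$ each. The Modular architecture is the bipartite graph on $I\cup J$ in which, for each $k$, every queue in $A_k$ is connected to every server in $B_k$, and there are no other edges (so every node has degree $d_n$). Arrival rates: $\Lambda_n(u_n)$ is the set of all non-negative vectors $\lambda=(\lambda_1,\dots,\lambda_n)$ with $\max_i\lambda_i<u_n$ and $\sum_{i=1}^n\lambda_i\le\rho n$. Capacity region: for a bipartite graph $g=(I\cup J,E)$, $\mathbf R(g)$ is the set of vectors $\lambda=(\lambda_i)_{i\in I}$ for which there exist $f_{ij}\ge0$, $(i,j)\in E$, with $\lambda_i=\sum_{j:(i,j)\in E}f_{ij}$ for all $i\in I$ and $\sum_{i:(i,j)\in E}f_{ij}<1$ for all $j\in J$. *)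

theory Defs
  imports Complex_Main "HOL-Library.Disjoint_Sets"
begin

text \<open>
  A bipartite graph on queues \<open>I\<close> and servers \<open>J\<close> is given by its edge set \<open>E \<subseteq> I \<times> J\<close>; as edges are
  ordered pairs, \<open>I\<close> and \<open>J\<close> are automatically kept apart.  A vector indexed by \<open>I\<close> is a function
  of which only the values on \<open>I\<close> matter.
\<close>

definition block_partition :: "'a set \<Rightarrow> nat \<Rightarrow> nat \<Rightarrow> (nat \<Rightarrow> 'a set) \<Rightarrow> bool" where
  "block_partition S m d A \<longleftrightarrow>
     disjoint_family_on A {1..m} \<and> (\<Union>k\<in>{1..m}. A k) = S \<and>
     (\<forall>k\<in>{1..m}. finite (A k) \<and> card (A k) = d)"

definition modular_architecture ::
    "nat \<Rightarrow> nat \<Rightarrow> 'i set \<Rightarrow> 'j set \<Rightarrow> ('i \<times> 'j) set \<Rightarrow> bool" where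
  "modular_architecture n d I J E \<longleftrightarrow>
     finite I \<and> card I = n \<and> finite J \<and> card J = n \<and> 0 < d \<and> d dvd n \<and>
     (\<exists>A B. block_partition I (n div d) d A \<and> block_partition J (n div d) d B \<and>
            E = (\<Union>k\<in>{1..n div d}. A k \<times> B k))"

definition arrival_rates :: "real \<Rightarrow> 'i set \<Rightarrow> real \<Rightarrow> ('i \<Rightarrow> real) set" where
  "arrival_rates \<rho> I u =
     {l. (\<forall>i\<in>I. 0 \<le> l i) \<and> Max (l ` I) < u \<and> (\<Sum>i\<in>I. l i) \<le> \<rho> * real (card I)}"

definition capacity_region :: "'i set \<Rightarrow> 'j set \<Rightarrow> ('i \<times> 'j) set \<Rightarrow> ('i \<Rightarrow> real) set" where
  "capacity_region I J E =
     {l. \<exists>f :: 'i \<Rightarrow> 'j \<Rightarrow> real.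
           (\<forall>(i, j)\<in>E. 0 \<le> f i j) \<and>
           (\<forall>i\<in>I. l i = (\<Sum>j | j \<in> J \<and> (i, j) \<in> E. f i j)) \<and>
           (\<forall>j\<in>J. (\<Sum>i | i \<in> I \<and> (i, j) \<in> E. f i j) < 1)}"

text \<open>
  Every node of a modular architecture has degree \<open>d\<close>, so the parameter \<open>d\<close> is the average degree.
\<close>

lemma block_neighbours:
  assumes "block_partition S m d A" "x \<in> S" "\<And>k. k \<in> {1..m} \<Longrightarrow> card (B k) = d"
  shows "card {y. \<exists>k\<in>{1..m}. x \<in> A k \<and> y \<in> B k} = d"
proof -
  obtain k where k: "k \<in> {1..m}" "x \<in> A k"
    using assms(1,2) by (auto simp: block_partition_def)
  have "k' = k" if "k' \<in> {1..m}" "x \<in> A k'" for k'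
    using assms(1) k that unfolding block_partition_def disjoint_family_on_def by blast
  then have "{y. \<exists>k\<in>{1..m}. x \<in> A k \<and> y \<in> B k} = B k"
    using k by blast
  with assms(3) k show ?thesis by simp
qed

lemma modular_architecture_degree:
  assumes "modular_architecture n d I J E"
  shows "\<And>i. i \<in> I \<Longrightarrow> card {j. (i, j) \<in> E} = d"
    and "\<And>j. j \<in> J \<Longrightarrow> card {i. (i, j) \<in> E} = d"
proof -
  obtain A B where A: "block_partition I (n div d) d A" and B: "block_partition J (n div d) d B"
    and E: "E = (\<Union>k\<in>{1..n div d}. A k \<times> B k)"
    using assms by (auto simp: modular_architecture_def)
  have c: "card (A k) = d" "card (B k) = d" if "k \<in> {1..n div d}" for k
    using A B that by (auto simp: block_partition_def)
  show "card {j. (i, j) \<in> E} = d" if "i \<in> I" for i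
    using block_neighbours[where B = B, OF A that] c by (simp add: E)
  show "card {i. (i, j) \<in> E} = d" if "j \<in> J" for j
    using block_neighbours[where B = A, OF B that] c by (simp add: E conj_commute)
qed

end

theory Submission
  imports Defs
begin

text \<open>
  A single block already defeats the architecture: its \<open>d\<close> queues can send work only to the \<open>d\<close>
  servers of the matching block, each of which must be loaded strictly below 1.  Let every queue of
  one block have rate 1 and all others rate 0.  These rates are below \<open>u\<close> because \<open>u > 1\<close>, and
  their total \<open>d \<le> \<rho> n / 2\<close> is within the budget \<open>\<rho> n\<close>, but the block receives total rate exactly
  \<open>d\<close>, which its servers cannot carry.  The last step is the cut condition
  \<open>capacity_region_cut\<close> below, applied to the block.
\<close>

text \<open>
  This is the necessary (Hall-type) half of the max-flow min-cut description of the capacity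
  region: all flow out of \<open>S\<close> passes through \<open>T\<close>, and since \<open>T\<close> is nonempty the strict
  capacity bounds of its servers add up to a strict bound.
\<close>

lemma capacity_region_cut:
  assumes l: "l \<in> capacity_region I J E"
    and fin: "finite I" and S: "S \<subseteq> I"
    and T: "finite T" "T \<noteq> {}" "T \<subseteq> J"
    and neighbours: "\<And>i j. i \<in> S \<Longrightarrow> j \<in> J \<Longrightarrow> (i, j) \<in> E \<Longrightarrow> j \<in> T"
  shows "(\<Sum>i\<in>S. l i) < real (card T)"
proof -
  obtain f :: "'a \<Rightarrow> 'b \<Rightarrow> real" where nonneg: "\<And>i j. (i, j) \<in> E \<Longrightarrow> 0 \<le> f i j"
    and out: "\<And>i. i \<in> I \<Longrightarrow> l i = (\<Sum>j | j \<in> J \<and> (i, j) \<in> E. f i j)"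
    and load: "\<And>j. j \<in> J \<Longrightarrow> (\<Sum>i | i \<in> I \<and> (i, j) \<in> E. f i j) < 1"
    using l unfolding capacity_region_def by blast
  have "finite S"
    using S fin by (rule finite_subset)
  have "(\<Sum>i\<in>S. l i) = (\<Sum>i\<in>S. \<Sum>j | j \<in> T \<and> (i, j) \<in> E. f i j)"
  proof (rule sum.cong[OF refl])
    fix i assume i: "i \<in> S"
    then have "{j. j \<in> J \<and> (i, j) \<in> E} = {j. j \<in> T \<and> (i, j) \<in> E}"
      using neighbours T(3) by blast
    with i S show "l i = (\<Sum>j | j \<in> T \<and> (i, j) \<in> E. f i j)"
      using out by auto
  qed
  also have "\<dots> = (\<Sum>j\<in>T. \<Sum>i | i \<in> S \<and> (i, j) \<in> E. f i j)"
    using \<open>finite S\<close> T(1) by (rule sum.swap_restrict)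
  also have "\<dots> \<le> (\<Sum>j\<in>T. \<Sum>i | i \<in> I \<and> (i, j) \<in> E. f i j)"
    using fin S nonneg by (intro sum_mono sum_mono2) auto
  also have "\<dots> < (\<Sum>j\<in>T. 1)"
    using T load by (intro sum_strict_mono) auto
  finally show ?thesis by simp
qed

theorem theorem3p5:
  fixes \<rho> u :: real and n d :: nat
    and I :: "'i set" and J :: "'j set" and E :: "('i \<times> 'j) set"
  assumes "0 < \<rho>" "\<rho> < 1" "n \<ge> 1" "u > 1"
    and "modular_architecture n d I J E"
    and "real d \<le> \<rho> / 2 * real n"
  shows "\<exists>l \<in> arrival_rates \<rho> I u. l \<notin> capacity_region I J E"
proof -
  obtain A B where fin: "finite I" and card: "card I = n" and d: "0 < d" "d dvd n"
    and A: "block_partition I (n div d) d A" and B: "block_partition J (n div d) d B"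
    and E: "E = (\<Union>k\<in>{1..n div d}. A k \<times> B k)"
    using assms(5) unfolding modular_architecture_def by blast
  have one: "1 \<in> {1..n div d}"
    using d \<open>n \<ge> 1\<close> by (auto simp: dvd_div_eq_0_iff Suc_le_eq elim!: dvdE)
  have A1: "A 1 \<subseteq> I" "finite (A 1)" "card (A 1) = d"
    and B1: "B 1 \<subseteq> J" "finite (B 1)" "card (B 1) = d"
    using A B one unfolding block_partition_def by auto
  define l :: "'i \<Rightarrow> real" where "l = (\<lambda>i. if i \<in> A 1 then 1 else 0)"
  have nonneg: "0 \<le> l i" for i
    by (simp add: l_def)
  have total: "(\<Sum>i\<in>A 1. l i) = real d"
    using A1 by (simp add: l_def)
  have "(\<Sum>i\<in>I. l i) = (\<Sum>i\<in>A 1. l i)"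
    using fin A1(1) by (intro sum.mono_neutral_right) (auto simp: l_def)
  also have "\<dots> \<le> \<rho> * real n"
    using assms(6) mult_nonneg_nonneg[of \<rho> "real n"] \<open>0 < \<rho>\<close> total by simp
  finally have load: "(\<Sum>i\<in>I. l i) \<le> \<rho> * real (card I)"
    by (simp add: card)
  have "I \<noteq> {}"
    using card \<open>n \<ge> 1\<close> by auto
  moreover have "l i < u" for i
    using \<open>u > 1\<close> by (simp add: l_def)
  ultimately have "Max (l ` I) < u"
    using fin by simp
  with load have "l \<in> arrival_rates \<rho> I u"
    by (simp add: arrival_rates_def nonneg)
  moreover have "l \<notin> capacity_region I J E"
  proof
    assume l: "l \<in> capacity_region I J E"
    have "B 1 \<noteq> {}"
      using B1 d by auto
    \<comment> \<open>The blocks \<open>A k\<close> are disjoint, so a queue of \<open>A 1\<close> has no edge from another block.\<close>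
    moreover have "j \<in> B 1" if ij: "i \<in> A 1" "(i, j) \<in> E" for i j
    proof -
      obtain k where k: "k \<in> {1..n div d}" "i \<in> A k" "j \<in> B k"
        using ij(2) E by blast
      have "disjoint_family_on A {1..n div d}"
        using A by (simp add: block_partition_def)
      then have "k = 1"
        using ij(1) k(1,2) one unfolding disjoint_family_on_def by blast
      with k(3) show ?thesis by simp
    qed
    ultimately have "(\<Sum>i\<in>A 1. l i) < real (card (B 1))"
      by (intro capacity_region_cut[OF l fin A1(1) B1(2) _ B1(1)])
    with total B1(3) show False by simp
  qed
  ultimately show ?thesis by blast
qed

end
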